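(* Let $\varphi(z)=1+B_1z+B_2z^2+B_3z^3+\cdots$ be analytic in $\mathbb{D}$ with $B_1>0$ and $B_2\in\mathbb{R}$. Let $f(z)=z+\sum_{n\ge2}a_nz^n$ belong to $\sigma$, with inverse $F=f^{-1}$ on $\mathbb{D}$, and suppose \[\frac{zf'(z)}{f(z)}\prec\varphi(z)\quad\text{and}\quad F'(w)\prec\varphi(w)\] (i.e. $f\in\mathcal{S}^*(\varphi)$ and $F\in\mathcal{R}(\varphi)$). Then \[|a_2|\le\frac{\sqrt{5\,(B_1+|B_2-B_1|)}}{3}\quad\text{and}\quad |a_3|\le\frac{7\,(B_1+|B_2-B_1|)}{9}.\]
   Context: $\mathbb{D}=\{z\in\mathbb{C}:|z|<1\}$. $\mathcal{A}$ denotes the class of analytic functions $f$ on $\mathbb{D}$ with $f(0)=0$, $f'(0)=1$, i.e. $f(z)=z+\sum_{n\ge2}a_nz^n$. The class $\sigma$ of bi-univalent functions consists of those $f\in\mathcal{A}$ that are univalent in $\mathbb{D}$ and whose inverse $f^{-1}$ (defined near $0$) extends to a univalent analytic function $F$ on $\mathbb{D}$; then $F(w)=w-a_2w^2+(2a_2^2-a_3)w^3+\cdots$. For analytic $g,h$ on $\mathbb{D}$, $g\prec h$ (subordination) means there is an analytic $\omega:\mathbb{D}\to\mathbb{D}$ with $\omega(0)=0$ and $g=h\circ\omega$. *)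

theory Defs
  imports "HOL-Analysis.Analysis"
begin

definition subordinate :: "(complex \<Rightarrow> complex) \<Rightarrow> (complex \<Rightarrow> complex) \<Rightarrow> bool" where
  "subordinate g h \<longleftrightarrow>
     (\<exists>\<omega>. \<omega> holomorphic_on ball 0 1 \<and> \<omega> ` ball 0 1 \<subseteq> ball 0 1 \<and> \<omega> 0 = 0 \<and>
          (\<forall>z\<in>ball 0 1. g z = h (\<omega> z)))"

definition classA :: "(complex \<Rightarrow> complex) \<Rightarrow> bool" where
  "classA f \<longleftrightarrow> f holomorphic_on ball 0 1 \<and> f 0 = 0 \<and> deriv f 0 = 1"

definition biunivalent_inverse :: "(complex \<Rightarrow> complex) \<Rightarrow> (complex \<Rightarrow> complex) \<Rightarrow> bool" where
  "biunivalent_inverse f F \<longleftrightarrow>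
     classA f \<and> inj_on f (ball 0 1) \<and>
     F holomorphic_on ball 0 1 \<and> inj_on F (ball 0 1) \<and>
     (\<exists>r>0. \<forall>w\<in>ball 0 r. F w \<in> ball 0 1 \<and> f (F w) = w)"

definition tcoeff :: "(complex \<Rightarrow> complex) \<Rightarrow> nat \<Rightarrow> complex" where
  "tcoeff f n = (deriv ^^ n) f 0 / of_nat (fact n)"

text \<open>z f'(z)/f(z), with its removable value 1 at z = 0.\<close>
definition starquot :: "(complex \<Rightarrow> complex) \<Rightarrow> complex \<Rightarrow> complex" where
  "starquot f z = (if z = 0 then 1 else z * deriv f z / f z)"

end

theory Submission
  imports Defs "HOL-Complex_Analysis.Complex_Analysis"
begin

text \<open>
  If \<open>g = \<phi> \<circ> \<omega>\<close> with \<open>\<omega> z = c\<^sub>1 z + c\<^sub>2 z^2 + \<dots>\<close> a Schwarz function, then the second coefficient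
  \<open>B\<^sub>1 c\<^sub>2 + B\<^sub>2 c\<^sub>1^2\<close> of \<open>g\<close> has modulus at most \<open>max B\<^sub>1 \<bar>B\<^sub>2\<bar> \<le> K = B\<^sub>1 + \<bar>B\<^sub>2 - B\<^sub>1\<bar>\<close>, because
  \<open>\<bar>c\<^sub>2\<bar> \<le> 1 - \<bar>c\<^sub>1\<bar>^2\<close>. Applied to \<open>z f'/f\<close> and \<open>F'\<close> this bounds \<open>X = 2 a\<^sub>3 - a\<^sub>2^2\<close> and
  \<open>Y = 3 (2 a\<^sub>2^2 - a\<^sub>3)\<close> by \<open>K\<close>, and the claim follows from \<open>9 a\<^sub>2^2 = 3 X + 2 Y\<close> and
  \<open>9 a\<^sub>3 = 6 X + Y\<close>.
\<close>

text \<open>Following \<open>g\<close> by the disc automorphism that sends \<open>g 0\<close> to 0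
  gives a self-map of the disc fixing 0, and the Schwarz lemma bounds its derivative by 1.\<close>

lemma Schwarz_Pick_at_0:
  assumes "g holomorphic_on ball 0 1" and "\<And>z. norm z < 1 \<Longrightarrow> norm (g z) < 1"
  shows "norm (deriv g 0) \<le> 1 - (norm (g 0))\<^sup>2"
proof -
  define a where "a = g 0"
  have a: "norm a < 1"
    using assms(2)[of 0] by (simp add: a_def)
  have na: "1 - cnj a * a = of_real (1 - (norm a)\<^sup>2)"
    using complex_norm_square[of a] by (simp add: mult.commute)
  have pos: "1 - (norm a)\<^sup>2 > 0"
    using a by (simp add: power_less_one_iff)
  have nz: "1 - cnj a * a \<noteq> 0"
    using pos unfolding na of_real_eq_0_iff by linarith
  have "(g has_field_derivative deriv g 0) (at 0)"
    using assms(1) by (intro holomorphic_derivI[of _ "ball 0 1"]) auto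
  \<comment> \<open>The Moebius map is (w - a) / (1 - cnj a * w). Its numerator vanishes at w = a,
    so its derivative there is just the reciprocal of the denominator.\<close>
  then have "((\<lambda>z. Moebius_function 0 a (g z)) has_field_derivative
      deriv g 0 / (1 - cnj a * a)) (at 0)"
    unfolding Moebius_function_simple using nz
    by (auto intro!: derivative_eq_intros simp flip: a_def)
  then have "deriv (\<lambda>z. Moebius_function 0 a (g z)) 0 = deriv g 0 / (1 - cnj a * a)"
    by (rule DERIV_imp_deriv)
  moreover have "norm (deriv (\<lambda>z. Moebius_function 0 a (g z)) 0) \<le> 1"
  proof (rule Schwarz_Lemma(2)[where \<xi> = 0])
    have "Moebius_function 0 a \<circ> g holomorphic_on ball 0 1"
      by (rule holomorphic_on_compose_gen[OF assms(1) Moebius_function_holomorphic[OF a]])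
        (use assms(2) in auto)
    then show "(\<lambda>z. Moebius_function 0 a (g z)) holomorphic_on ball 0 1"
      by (simp add: o_def)
  qed (use a assms(2) in \<open>auto simp: Moebius_function_norm_lt_1 Moebius_function_eq_zero a_def\<close>)
  ultimately have "norm (deriv g 0) / \<bar>1 - (norm a)\<^sup>2\<bar> \<le> 1"
    unfolding na by (simp add: norm_divide del: of_real_diff)
  then show ?thesis
    using pos by (simp add: a_def divide_simps)
qed

text \<open>Writing \<omega> z = z * h z, the first two coefficients of \<omega> become
  \<open>h 0\<close> and \<open>deriv h 0\<close>, and Schwarz-Pick for \<open>h\<close> relates
  these.\<close>

lemma Schwarz_second_coeff:
  assumes holo: "\<omega> holomorphic_on ball 0 1" and "\<omega> ` ball 0 1 \<subseteq> ball 0 1" and "\<omega> 0 = 0"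
    and U: "\<omega> has_fps_expansion U"
  shows "norm (fps_nth U 2) \<le> 1 - (norm (fps_nth U 1))\<^sup>2"
proof -
  have no: "norm (\<omega> z) < 1" if "norm z < 1" for z
    using assms(2) that by (simp add: image_subset_iff)
  obtain h where h: "h holomorphic_on ball 0 1"
    and \<omega>_eq: "\<And>z. norm z < 1 \<Longrightarrow> \<omega> z = z * h z" and h0: "deriv \<omega> 0 = h 0"
    by (rule Schwarz3[OF holo \<open>\<omega> 0 = 0\<close>]) auto
  have ev: "eventually (\<lambda>z. z \<in> ball 0 1) (nhds (0::complex))"
    by (intro eventually_nhds_in_open) auto
  show ?thesis
  \<comment> \<open>Schwarz-Pick requires \<open>h\<close> to map into the open disc, which fails
    exactly in the equality case of the Schwarz lemma. There \<omega> is a rotation and both sides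
    of the claim are 0.\<close>
  proof (cases "(\<exists>z. norm z < 1 \<and> z \<noteq> 0 \<and> norm (\<omega> z) = norm z) \<or> norm (deriv \<omega> 0) = 1")
    case True
    then obtain \<alpha> where \<alpha>: "\<And>z. norm z < 1 \<Longrightarrow> \<omega> z = \<alpha> * z" "norm \<alpha> = 1"
      using Schwarz_Lemma(3)[OF holo \<open>\<omega> 0 = 0\<close> no, of 0] by auto
    have "(\<lambda>z. \<alpha> * z) has_fps_expansion fps_const \<alpha> * fps_X"
      by (intro fps_expansion_intros)
    moreover have "eventually (\<lambda>z. \<omega> z = \<alpha> * z) (nhds 0)"
      using ev by eventually_elim (simp add: \<alpha>)
    ultimately have "\<omega> has_fps_expansion fps_const \<alpha> * fps_X"
      by (rule has_fps_expansion_cong[THEN iffD2, OF _ refl, rotated])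
    then have "U = fps_const \<alpha> * fps_X"
      using U fps_expansion_unique_complex by blast
    then show ?thesis
      using \<alpha>(2) by simp
  next
    case False
    \<comment> \<open>Outside the equality case the Schwarz lemma is strict: away from 0 divide by
      \<open>norm z\<close>, at 0 use \<open>h 0 = deriv \<omega> 0\<close>.\<close>
    have "norm (h z) < 1" if "norm z < 1" for z
    proof (cases "z = 0")
      case True
      then show ?thesis
        using Schwarz_Lemma(2)[OF holo \<open>\<omega> 0 = 0\<close> no, of 0] False h0 by force
    next
      case z: False
      then have "norm (\<omega> z) < norm z"
        using Schwarz_Lemma(1)[OF holo \<open>\<omega> 0 = 0\<close> no that] False that by force
      then show ?thesis
        using z \<omega>_eq[OF that] by (simp add: norm_mult)
    qed
    then have SP: "norm (deriv h 0) \<le> 1 - (norm (h 0))\<^sup>2"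
      by (rule Schwarz_Pick_at_0[OF h])
    have H: "h has_fps_expansion fps_expansion h 0"
      using h by (intro has_fps_expansion_fps_expansion[of "ball 0 1"]) auto
    then have "(\<lambda>z. z * h z) has_fps_expansion fps_X * fps_expansion h 0"
      by (intro fps_expansion_intros)
    moreover have "eventually (\<lambda>z. \<omega> z = z * h z) (nhds 0)"
      using ev by eventually_elim (simp add: \<omega>_eq)
    ultimately have "\<omega> has_fps_expansion fps_X * fps_expansion h 0"
      by (rule has_fps_expansion_cong[THEN iffD2, OF _ refl, rotated])
    then have "U = fps_X * fps_expansion h 0"
      using U fps_expansion_unique_complex by blast
    then show ?thesis
      using SP by (simp add: fps_expansion_def)
  qed
qed

lemma fps_compose_nth_1:
  fixes P U :: "'a::comm_ring_1 fps"
  assumes "fps_nth U 0 = 0"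
  shows "fps_nth (P oo U) 1 = fps_nth P 1 * fps_nth U 1"
  using assms by (simp add: fps_compose_nth)

lemma fps_compose_nth_2:
  fixes P U :: "'a::comm_ring_1 fps"
  assumes "fps_nth U 0 = 0"
  shows "fps_nth (P oo U) 2 = fps_nth P 1 * fps_nth U 2 + fps_nth P 2 * (fps_nth U 1)\<^sup>2"
  using assms
  by (simp add: fps_compose_nth numeral_2_eq_2 fps_mult_nth sum.atLeast_Suc_atMost power2_eq_square)

lemma fps_compose_nth_3:
  fixes P U :: "'a::comm_ring_1 fps"
  assumes "fps_nth U 0 = 0"
  shows "fps_nth (P oo U) 3 =
    fps_nth P 1 * fps_nth U 3 + 2 * fps_nth P 2 * fps_nth U 1 * fps_nth U 2
    + fps_nth P 3 * fps_nth U 1 ^ 3"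
  using assms
  by (simp add: fps_compose_nth numeral_3_eq_3 numeral_2_eq_2 fps_mult_nth sum.atLeast_Suc_atMost
      algebra_simps)

text \<open>The series \<open>G\<close> is the composition of the series of \<phi> and \<omega>, so
  subordination itself supplies the expansions of \<open>starquot f\<close> and
  \<open>deriv F\<close>.\<close>

lemma subordinate_fps_expansion:
  fixes B1 B2 :: real
  assumes \<phi>: "\<phi> holomorphic_on ball 0 1"
    and B1: "tcoeff \<phi> 1 = of_real B1" "B1 \<ge> 0" and B2: "tcoeff \<phi> 2 = of_real B2"
    and "subordinate g \<phi>"
  obtains G where "g has_fps_expansion G" and "fps_nth G 0 = \<phi> 0"
    and "norm (fps_nth G 2) \<le> B1 + \<bar>B2 - B1\<bar>"
proof -
  obtain \<omega> where \<omega>: "\<omega> holomorphic_on ball 0 1" "\<omega> ` ball 0 1 \<subseteq> ball 0 1" "\<omega> 0 = 0"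
    and g: "\<And>z. z \<in> ball 0 1 \<Longrightarrow> g z = \<phi> (\<omega> z)"
    using assms(5) unfolding subordinate_def by blast
  define P where "P = fps_expansion \<phi> 0"
  define U where "U = fps_expansion \<omega> 0"
  have P: "\<phi> has_fps_expansion P"
    unfolding P_def using \<phi> by (intro has_fps_expansion_fps_expansion[of "ball 0 1"]) auto
  have U: "\<omega> has_fps_expansion U"
    unfolding U_def using \<omega> by (intro has_fps_expansion_fps_expansion[of "ball 0 1"]) auto
  have U0: "fps_nth U 0 = 0"
    by (simp add: U_def fps_expansion_def \<omega>)
  have "(\<phi> \<circ> \<omega>) has_fps_expansion (P oo U)"
    using P U U0 by (rule has_fps_expansion_compose)
  moreover have "eventually (\<lambda>z. z \<in> ball 0 1) (nhds (0::complex))"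
    by (intro eventually_nhds_in_open) auto
  then have "eventually (\<lambda>z. g z = (\<phi> \<circ> \<omega>) z) (nhds 0)"
    by eventually_elim (simp add: g)
  ultimately have "g has_fps_expansion (P oo U)"
    by (rule has_fps_expansion_cong[THEN iffD2, OF _ refl, rotated])
  moreover have "fps_nth (P oo U) 0 = \<phi> 0"
    by (simp add: P_def fps_expansion_def)
  moreover have "norm (fps_nth (P oo U) 2) \<le> B1 + \<bar>B2 - B1\<bar>"
  proof -
    define x where "x = (norm (fps_nth U 1))\<^sup>2"
    have x: "norm (fps_nth U 2) \<le> 1 - x" "x \<ge> 0"
      using Schwarz_second_coeff[OF \<omega> U] by (auto simp: x_def)
    have "fps_nth (P oo U) 2 = of_real B1 * fps_nth U 2 + of_real B2 * (fps_nth U 1)\<^sup>2"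
      using fps_nth_fps_expansion[OF P] fps_compose_nth_2[OF U0, of P] B1(1) B2
      by (simp add: tcoeff_def)
    also have "norm \<dots> \<le> B1 * norm (fps_nth U 2) + \<bar>B2\<bar> * x"
      by (rule norm_triangle_le) (use B1(2) in \<open>simp add: norm_mult norm_power x_def\<close>)
    \<comment> \<open>The triangle inequality gives \<bar>B2\<bar> \<le> B1 + \<bar>B2 - B1\<bar>.
      The bound is now a convex combination of \<open>B1\<close> and this larger number, with weight
      \<open>x\<close> in [0, 1].\<close>
    also have "\<dots> \<le> B1 * (1 - x) + (B1 + \<bar>B2 - B1\<bar>) * x"
      using x B1(2) by (intro add_mono mult_left_mono mult_right_mono) auto
    also have "\<dots> = B1 + \<bar>B2 - B1\<bar> * x"
      by (simp add: algebra_simps)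
    also have "\<dots> \<le> B1 + \<bar>B2 - B1\<bar>"
    proof -
      have "x \<le> 1"
        using x norm_ge_zero[of "fps_nth U 2"] by linarith
      then show ?thesis
        by (simp add: mult_left_le)
    qed
    finally show ?thesis .
  qed
  ultimately show thesis
    using that by blast
qed

text \<open>Clearing the denominator turns the quotient into z f' = G f. Its coefficients of order 2
  and 3 determine those of \<open>G\<close> of order 1 and 2.\<close>

lemma starquot_coeffs:
  assumes "inj_on f (ball 0 1)" "f 0 = 0"
    and A: "f has_fps_expansion A" and A1: "fps_nth A 1 = 1"
    and G: "starquot f has_fps_expansion G" and G0: "fps_nth G 0 = 1"
  shows "fps_nth G 2 = 2 * fps_nth A 3 - (fps_nth A 2)\<^sup>2"
proof -
  have A0: "fps_nth A 0 = 0"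
    using fps_nth_fps_expansion[OF A, of 0] \<open>f 0 = 0\<close> by simp
  have "eventually (\<lambda>z. z \<in> ball 0 1) (nhds (0::complex))"
    by (intro eventually_nhds_in_open) auto
  then have "eventually (\<lambda>z. z * deriv f z = starquot f z * f z) (nhds 0)"
  proof eventually_elim
    case (elim z)
    \<comment> \<open>Injectivity makes 0 the only zero of \<open>f\<close>, so multiplying by
      \<open>f z\<close> cancels the denominator elsewhere; at 0 both sides vanish.\<close>
    have "z \<noteq> 0 \<Longrightarrow> f z \<noteq> 0"
      using inj_onD[OF assms(1), of z 0] elim \<open>f 0 = 0\<close> by auto
    then show ?case
      using \<open>f 0 = 0\<close> by (auto simp: starquot_def)
  qed
  moreover have "(\<lambda>z. starquot f z * f z) has_fps_expansion G * A"
    using G A by (intro fps_expansion_intros)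
  ultimately have "(\<lambda>z. z * deriv f z) has_fps_expansion G * A"
    by (rule has_fps_expansion_cong[THEN iffD2, OF _ refl])
  moreover have "(\<lambda>z. z * deriv f z) has_fps_expansion fps_X * fps_deriv A"
    using A by (intro fps_expansion_intros)
  ultimately have eq: "fps_X * fps_deriv A = G * A"
    using fps_expansion_unique_complex by blast
  have "fps_nth G 1 = fps_nth A 2"
    using arg_cong[OF eq, of "\<lambda>F. fps_nth F 2"] A0 A1 G0
    by (simp add: fps_mult_nth numeral_2_eq_2)
  then show ?thesis
    using arg_cong[OF eq, of "\<lambda>F. fps_nth F 3"] A0 A1 G0
    by (simp add: fps_mult_nth numeral_3_eq_3 numeral_2_eq_2 power2_eq_square algebra_simps)
qed

text \<open>Near 0 the composition of \<open>f\<close> with \<open>F\<close> is the identity, so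
  \<open>A oo C = fps_X\<close>. Its coefficients of order 1, 2, 3 are solved in turn for those of
  \<open>C\<close>.\<close>

lemma biunivalent_inverse_coeffs:
  assumes "biunivalent_inverse f F"
    and A: "f has_fps_expansion A" and C: "F has_fps_expansion C"
  shows "fps_nth C 3 = 2 * (fps_nth A 2)\<^sup>2 - fps_nth A 3"
proof -
  have f: "inj_on f (ball 0 1)" "f 0 = 0" "deriv f 0 = 1"
    using assms(1) by (auto simp: biunivalent_inverse_def classA_def)
  obtain r where r: "r > 0" "\<And>w. w \<in> ball 0 r \<Longrightarrow> F w \<in> ball 0 1 \<and> f (F w) = w"
    using assms(1) by (auto simp: biunivalent_inverse_def)
  \<comment> \<open>Composing the two series requires \<open>C\<close> to have constant term 0; this
    comes from \<open>f (F 0) = 0 = f 0\<close> and injectivity of \<open>f\<close>.\<close>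
  have "F 0 = 0"
    using inj_onD[OF f(1), of "F 0" 0] r(2)[of 0] r(1) f(2) by simp
  then have C0: "fps_nth C 0 = 0"
    using fps_nth_fps_expansion[OF C, of 0] by simp
  have A1: "fps_nth A 1 = 1"
    using fps_nth_fps_expansion[OF A, of 1] f(3) by simp
  have "(f \<circ> F) has_fps_expansion (A oo C)"
    using A C C0 by (rule has_fps_expansion_compose)
  moreover have "eventually (\<lambda>w. w \<in> ball 0 r) (nhds (0::complex))"
    using r(1) by (intro eventually_nhds_in_open) auto
  then have "eventually (\<lambda>w. w = (f \<circ> F) w) (nhds 0)"
    by eventually_elim (use r(2) in auto)
  ultimately have "(\<lambda>w. w) has_fps_expansion (A oo C)"
    by (rule has_fps_expansion_cong[THEN iffD2, OF _ refl, rotated])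
  then have eq: "A oo C = fps_X"
    using has_fps_expansion_fps_X fps_expansion_unique_complex by blast
  have C1: "fps_nth C 1 = 1"
    using fps_compose_nth_1[OF C0, of A] A1 by (simp add: eq)
  have C2: "fps_nth C 2 = - fps_nth A 2"
    using fps_compose_nth_2[OF C0, of A] A1 C1 by (simp add: eq eq_neg_iff_add_eq_0)
  show ?thesis
    using fps_compose_nth_3[OF C0, of A] A1 C1 C2 by (simp add: eq power2_eq_square algebra_simps)
qed

theorem theorem5:
  fixes \<phi> f F :: "complex \<Rightarrow> complex" and B1 B2 :: real
  assumes "\<phi> holomorphic_on ball 0 1" and "\<phi> 0 = 1"
    and "tcoeff \<phi> 1 = complex_of_real B1" and "B1 > 0"
    and "tcoeff \<phi> 2 = complex_of_real B2"
    and "biunivalent_inverse f F"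
    and "subordinate (starquot f) \<phi>"
    and "subordinate (deriv F) \<phi>"
  shows "norm (tcoeff f 2) \<le> sqrt (5 * (B1 + \<bar>B2 - B1\<bar>)) / 3
    \<and> norm (tcoeff f 3) \<le> 7 * (B1 + \<bar>B2 - B1\<bar>) / 9"
proof -
  define K where "K = B1 + \<bar>B2 - B1\<bar>"
  have f: "f holomorphic_on ball 0 1" "inj_on f (ball 0 1)" "f 0 = 0" "deriv f 0 = 1"
    and F: "F holomorphic_on ball 0 1"
    using assms(6) by (auto simp: biunivalent_inverse_def classA_def)
  define A where "A = fps_expansion f 0"
  define C where "C = fps_expansion F 0"
  have A: "f has_fps_expansion A"
    unfolding A_def using f by (intro has_fps_expansion_fps_expansion[of "ball 0 1"]) auto
  have C: "F has_fps_expansion C"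
    unfolding C_def using F by (intro has_fps_expansion_fps_expansion[of "ball 0 1"]) auto
  define a2 a3 where "a2 = fps_nth A 2" and "a3 = fps_nth A 3"
  have a: "tcoeff f 2 = a2" "tcoeff f 3 = a3"
    unfolding a2_def a3_def tcoeff_def fps_nth_fps_expansion[OF A] by simp_all
  have A1: "fps_nth A 1 = 1"
    using fps_nth_fps_expansion[OF A, of 1] f(4) by simp
  note sub = subordinate_fps_expansion[OF assms(1,3) less_imp_le[OF assms(4)] assms(5)]
  \<comment> \<open>\<open>X\<close> and \<open>Y\<close> are the second coefficients of z f'/f and
    of F'. The factor 3 in \<open>Y\<close> comes from differentiating the cubic term of
    \<open>F\<close>.\<close>
  define X where "X = 2 * a3 - a2\<^sup>2"
  define Y where "Y = 3 * (2 * a2\<^sup>2 - a3)"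
  have X: "norm X \<le> K"
  proof -
    obtain G where "starquot f has_fps_expansion G" "fps_nth G 0 = \<phi> 0" "norm (fps_nth G 2) \<le> K"
      using sub[OF assms(7)] unfolding K_def by blast
    then show ?thesis
      using starquot_coeffs[OF f(2,3) A A1] assms(2) by (simp add: X_def a2_def a3_def)
  qed
  have Y: "norm Y \<le> K"
  proof -
    obtain G where G: "deriv F has_fps_expansion G" "norm (fps_nth G 2) \<le> K"
      using sub[OF assms(8)] unfolding K_def by blast
    have "G = fps_deriv C"
      using has_fps_expansion_deriv[OF C] G(1) fps_expansion_unique_complex by blast
    then have "fps_nth G 2 = Y"
      using biunivalent_inverse_coeffs[OF assms(6) A C]
      by (simp add: Y_def a2_def a3_def)
    then show ?thesis
      using G(2) by simp
  qed
  \<comment> \<open>The weights 3 and 2 cancel \<open>a3\<close>; their sum is the 5 in the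
    bound.\<close>
  have "9 * (norm a2)\<^sup>2 = norm (3 * X + 2 * Y)"
  proof -
    have "3 * X + 2 * Y = 9 * a2\<^sup>2"
      by (simp add: X_def Y_def algebra_simps)
    then show ?thesis
      by (simp add: norm_mult norm_power)
  qed
  also have "\<dots> \<le> 3 * norm X + 2 * norm Y"
    by (rule norm_triangle_le) (simp add: norm_mult)
  also have "\<dots> \<le> 5 * K"
    using X Y by simp
  finally have "(3 * norm a2)\<^sup>2 \<le> 5 * K"
    by (simp add: power_mult_distrib)
  then have "3 * norm a2 \<le> sqrt (5 * K)"
    by (rule real_le_rsqrt)
  moreover have "9 * norm a3 \<le> 7 * K"
  proof -
    \<comment> \<open>The weights 6 and 1 cancel the square of \<open>a2\<close>; their sum is the 7
      in the bound.\<close>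
    have "6 * X + Y = 9 * a3"
      by (simp add: X_def Y_def algebra_simps)
    then have "9 * norm a3 = norm (6 * X + Y)"
      by (simp add: norm_mult)
    also have "\<dots> \<le> 6 * norm X + norm Y"
      by (rule norm_triangle_le) (simp add: norm_mult)
    also have "\<dots> \<le> 7 * K"
      using X Y by simp
    finally show ?thesis .
  qed
  ultimately show ?thesis
    unfolding a K_def by auto
qed

end
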